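(* Let $X$ be a uniform space with uniformity $\mathcal{U}$ and let $f : X \to X$ be a topologically expansive homeomorphism. Then $X$ is a Hausdorff space.
   Context: A uniform space $(X,\mathcal{U})$ carries the topology in which a set $T\subseteq X$ is open iff for every $x\in T$ there is $U\in\mathcal{U}$ with $U[x]=\{y : (x,y)\in U\}\subseteq T$; topological terms (homeomorphism, Hausdorff) refer to this topology. Members of $\mathcal{U}$ are called entourages. For an entourage $D\in\mathcal{U}$, a homeomorphism $f:X\to X$ and $x\in X$, let $\Gamma_D(x,f)=\{y\in X : (f^n(x),f^n(y))\in D \text{ for all } n\in\mathbb{Z}\}$. A homeomorphism $f:X\to X$ is topologically expansive if there exists an entourage $A\in\mathcal{U}$ such that $\Gamma_A(x,f)=\{x\}$ for every $x\in X$. *)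

theory Defs
  imports "HOL-Analysis.Analysis"
begin

(* In the class uniform_space the uniformity is a filter on 'a \<times> 'a; its members are
   the sets D on which it is eventually concentrated. The class axiom open_uniformity
   is the usual description of the induced topology. *)
definition entourage :: "('a::uniform_space \<times> 'a) set \<Rightarrow> bool" where
  "entourage D \<longleftrightarrow> (\<forall>\<^sub>F p in uniformity. p \<in> D)"

(* Meaningful as the integer power f^n only for bijective f. *)
definition int_iterate :: "('a \<Rightarrow> 'a) \<Rightarrow> int \<Rightarrow> 'a \<Rightarrow> 'a" where
  "int_iterate f n = (if 0 \<le> n then f ^^ nat n else inv f ^^ nat (- n))"

definition Gamma_set :: "('a \<times> 'a) set \<Rightarrow> 'a \<Rightarrow> ('a \<Rightarrow> 'a) \<Rightarrow> 'a set" where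
  "Gamma_set D x f = {y. \<forall>n::int. (int_iterate f n x, int_iterate f n y) \<in> D}"

definition topologically_expansive :: "('a::uniform_space \<Rightarrow> 'a) \<Rightarrow> bool" where
  "topologically_expansive f \<longleftrightarrow>
     homeomorphism UNIV UNIV f (inv f) \<and> (\<exists>A. entourage A \<and> (\<forall>x. Gamma_set A x f = {x}))"

end

theory Submission
  imports Defs
begin

text \<open>
  Two points that some entourage fails to relate have disjoint neighbourhoods
  (\<open>not_entourage_imp_separated\<close>). In a general uniform space distinct points may be related by
  every entourage, but expansivity separates their orbits: for \<open>x \<noteq> y\<close> there is an
  integer \<open>n\<close> with \<open>(f^n x, f^n y)\<close> outside the expansivity entourage. Since \<open>f^n\<close> is continuous
  (\<open>continuous_on_int_iterate\<close>; for negative \<open>n\<close> this uses continuity of the inverse), the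
  preimages under \<open>f^n\<close> of disjoint open sets around \<open>f^n x\<close> and \<open>f^n y\<close> separate \<open>x\<close> from \<open>y\<close>.
\<close>

text \<open>
  Choose an entourage \<open>D\<close> with \<open>D O D \<subseteq> A\<close>. The sections \<open>D[a]\<close> and \<open>D\<inverse>[b]\<close> are neighbourhoods
  of \<open>a\<close> and \<open>b\<close>, and a common point \<open>z\<close> would give \<open>(a, z) \<in> D\<close> and \<open>(z, b) \<in> D\<close>, hence
  \<open>(a, b) \<in> A\<close>.
\<close>
lemma not_entourage_imp_separated:
  fixes a b :: "'a::uniform_space"
  assumes "entourage A" and "(a, b) \<notin> A"
  obtains U V where "open U" "open V" "a \<in> U" "b \<in> V" "U \<inter> V = {}"
proof -
  from assms(1) obtain D where D: "eventually D uniformity"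
    and DD: "\<And>x y z. D (x, y) \<Longrightarrow> D (y, z) \<Longrightarrow> (x, z) \<in> A"
    unfolding entourage_def by (rule uniformity_transE) blast
  have "eventually (\<lambda>z. D (a, z)) (nhds a)"
    unfolding eventually_nhds_uniformity using D by eventually_elim auto
  then obtain U where U: "open U" "a \<in> U" "\<And>z. z \<in> U \<Longrightarrow> D (a, z)"
    unfolding eventually_nhds by blast
  have "eventually (\<lambda>(x, y). D (y, x)) uniformity"
    using D by (rule uniformity_sym)
  then have "eventually (\<lambda>z. D (z, b)) (nhds b)"
    unfolding eventually_nhds_uniformity by eventually_elim auto
  then obtain V where V: "open V" "b \<in> V" "\<And>z. z \<in> V \<Longrightarrow> D (z, b)"
    unfolding eventually_nhds by blast
  have "U \<inter> V = {}"
    using U(3) V(3) DD assms(2) by blast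
  with U V that show thesis by blast
qed

lemma continuous_on_funpow:
  fixes g :: "'a::topological_space \<Rightarrow> 'a"
  assumes "continuous_on UNIV g"
  shows "continuous_on UNIV (g ^^ k)"
proof (induction k)
  case 0
  show ?case by (simp add: id_def)
next
  case (Suc k)
  have "continuous_on UNIV (g \<circ> (g ^^ k))"
    using Suc continuous_on_subset[OF assms subset_UNIV] by (rule continuous_on_compose)
  then show ?case by simp
qed

lemma continuous_on_int_iterate:
  assumes "homeomorphism UNIV UNIV f (inv f)"
  shows "continuous_on UNIV (int_iterate f n)"
  using assms unfolding int_iterate_def homeomorphism_def
  by (simp add: continuous_on_funpow)

theorem proposition3p6:
  fixes f :: "'a::uniform_space \<Rightarrow> 'a"
  assumes "topologically_expansive f"
  shows "Hausdorff_space (euclidean :: 'a topology)"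
proof -
  from assms obtain A where hom: "homeomorphism UNIV UNIV f (inv f)"
    and A: "entourage A" and Gamma: "\<And>x. Gamma_set A x f = {x}"
    unfolding topologically_expansive_def by blast
  have "\<exists>U V. open U \<and> open V \<and> x \<in> U \<and> y \<in> V \<and> disjnt U V" if "x \<noteq> y" for x y :: 'a
  proof -
    have "y \<notin> Gamma_set A x f"
      using Gamma that by simp
    then obtain n where n: "(int_iterate f n x, int_iterate f n y) \<notin> A"
      unfolding Gamma_set_def by blast
    let ?g = "int_iterate f n"
    obtain U V where UV: "open U" "open V" "?g x \<in> U" "?g y \<in> V" "U \<inter> V = {}"
      using A n by (rule not_entourage_imp_separated)
    have "open (?g -` U)" "open (?g -` V)"
      using continuous_on_int_iterate[OF hom] UV(1,2) by (simp_all add: open_vimage)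
    moreover have "disjnt (?g -` U) (?g -` V)"
      using UV(5) by (auto simp: disjnt_def)
    ultimately show ?thesis
      using UV(3,4) by blast
  qed
  then show ?thesis
    unfolding Hausdorff_space_def by simp
qed

end
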